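(* Let $l<u$, $b>0$, $n\ge1$, and let $d_1,\dots,d_n$ be i.i.d. $\sim U[l,u]$. Let $\tau$ be the pivot of $d=(d_1,\dots,d_n)$ for the simplex $\Delta_b$ and $\mathcal{I}_\tau:=\{i\in\{1,\dots,n\}: d_i>\tau\}$. Then $$E[|\mathcal{I}_\tau|]<\sqrt{\frac{2b(n+1)}{u-l}+\frac14}+\frac12 .$$
   Context: $\Delta_b:=\{v\in\mathbb{R}^n:\sum_{i=1}^n v_i=b,\ v\ge0\}$ and $\mathrm{proj}_{\Delta_b}(d):=\mathrm{argmin}_{v\in\Delta_b}\|v-d\|_2$. The pivot $\tau$ is the unique real number with $\mathrm{proj}_{\Delta_b}(d)_i=\max\{d_i-\tau,0\}$ for all $i$; thus $\mathcal{I}_\tau$ is the set of indices of the nonzero entries of the projection. *)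

theory Defs
  imports "HOL-Probability.Probability"
begin

definition simplex_b :: "real \<Rightarrow> (real ^ 'n) set" where
  "simplex_b b = {v. (\<Sum>i\<in>UNIV. v $ i) = b \<and> (\<forall>i. 0 \<le> v $ i)}"

(* closest_point S d is the point of S at minimal Euclidean distance from d,
   i.e. the argmin of the norm of v - d over S; for b > 0 the simplex is nonempty,
   closed and convex, so this point exists and is unique. *)
definition proj_simplex :: "real \<Rightarrow> real ^ 'n \<Rightarrow> real ^ 'n" where
  "proj_simplex b d = closest_point (simplex_b b) d"

(* For b > 0 there is exactly one such real number; it may be negative. *)
definition pivot :: "real \<Rightarrow> real ^ 'n \<Rightarrow> real" where
  "pivot b d = (THE \<tau>. \<forall>i. proj_simplex b d $ i = max (d $ i - \<tau>) 0)"

definition active_set :: "real \<Rightarrow> real ^ 'n \<Rightarrow> 'n set" where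
  "active_set b d = {i. d $ i > pivot b d}"

end

theory Submission
  imports Defs
begin

text \<open>An index \<open>j\<close> is active iff the excess \<open>\<Sum>i. max (d i - t) 0\<close> at \<open>t = d j\<close> is below \<open>b\<close>. As a
  function of \<open>t\<close>, the excess of the other coordinates has slope minus the number of them above \<open>t\<close>.
  So integrating first over \<open>d j\<close>, the expected number of coordinates above an active \<open>d j\<close> is at most
  \<open>b / (u - l)\<close>. Summing over \<open>j\<close> counts the pairs of active indices, which gives
  \<open>E[K (K - 1)] \<le> 2 n b / (u - l)\<close> for the number \<open>K\<close> of active indices, and \<open>(E[K])\<^sup>2 \<le> E[K\<^sup>2]\<close>
  turns this into the bound on \<open>E[K]\<close>.\<close>

section \<open>Excess levels, the projection onto the simplex and its pivot\<close>

lemma exists_excess_level: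
  fixes x :: "'i \<Rightarrow> real"
  assumes "finite I" "I \<noteq> {}" "b \<ge> 0"
  shows "\<exists>s. (\<Sum>i\<in>I. max (x i - s) 0) = b"
proof -
  define m where "m = Max (x ` I)"
  have "m \<in> x ` I"
    unfolding m_def using assms by (intro Max_in) auto
  then obtain k where k: "k \<in> I" "x k = m"
    by auto
  \<comment> \<open>Endpoints for the intermediate value theorem: at the maximum \<open>m\<close>
    the excess vanishes, and at \<open>m - b\<close> the maximal coordinate alone contributes
    \<open>b\<close>.\<close>
  have "(\<Sum>i\<in>I. max (x i - m) 0) = 0"
    using assms by (auto simp: m_def intro!: sum.neutral max_absorb2)
  moreover have "b \<le> (\<Sum>i\<in>I. max (x i - (m - b)) 0)"
    using member_le_sum[of k I "\<lambda>i. max (x i - (m - b)) 0"] k assms by auto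
  ultimately have "\<exists>s. m - b \<le> s \<and> s \<le> m \<and> (\<Sum>i\<in>I. max (x i - s) 0) = b"
    using assms by (intro IVT2') (auto intro!: continuous_intros)
  then show ?thesis by blast
qed

lemma convex_simplex_b: "convex (simplex_b b)"
  unfolding convex_def simplex_b_def
  by (simp add: sum.distrib sum_distrib_left[symmetric] distrib_right[symmetric])

lemma closed_simplex_b: "closed (simplex_b b)"
  unfolding simplex_b_def
  by (intro closed_Collect_conj closed_Collect_eq closed_Collect_all closed_Collect_le
      continuous_intros)

text \<open>Variational inequality for the candidate \<open>p\<close>: \<open>d - p\<close> equals
  \<open>t\<close> on the support of \<open>p\<close> and is at most \<open>t\<close> elsewhere.
  Since \<open>p\<close> and \<open>v\<close> have the same sum,
  \<open>(d - p) \<bullet> (p - v)\<close> is nonnegative for every \<open>v\<close> in the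
  simplex.\<close>

lemma proj_simplex_eqI:
  fixes d :: "real ^ 'n"
  assumes "(\<Sum>i\<in>UNIV. max (d $ i - t) 0) = b"
  shows "proj_simplex b d = (\<chi> i. max (d $ i - t) 0)"
proof -
  define p :: "real ^ 'n" where "p = (\<chi> i. max (d $ i - t) 0)"
  have p: "p \<in> simplex_b b"
    using assms by (simp add: p_def simplex_b_def)
  have "dist d p \<le> dist d v" if v: "v \<in> simplex_b b" for v
  proof -
    have "0 = t * (\<Sum>i\<in>UNIV. p $ i - v $ i)"
      using v p by (simp add: simplex_b_def sum_subtractf)
    also have "\<dots> \<le> (\<Sum>i\<in>UNIV. (d $ i - p $ i) * (p $ i - v $ i))"
      unfolding sum_distrib_left
    proof (rule sum_mono)
      fix i
      \<comment> \<open>This is the gap between the two sides when \<open>d $ i < t\<close>, where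
        \<open>p $ i = 0\<close>; otherwise \<open>d $ i - p $ i = t\<close> and the sides
        agree.\<close>
      have "0 \<le> (t - d $ i) * v $ i" if "d $ i < t"
        using that v by (intro mult_nonneg_nonneg) (auto simp: simplex_b_def)
      then show "t * (p $ i - v $ i) \<le> (d $ i - p $ i) * (p $ i - v $ i)"
        by (cases "d $ i < t") (auto simp: p_def algebra_simps max_def)
    qed
    also have "\<dots> = (d - p) \<bullet> (p - v)"
      by (simp add: inner_vec_def)
    finally have "0 \<le> (d - p) \<bullet> (p - v)" .
    moreover have "(norm (d - v))\<^sup>2 = (norm (d - p))\<^sup>2 + 2 * ((d - p) \<bullet> (p - v)) + (norm (p - v))\<^sup>2"
      by (simp add: power2_norm_eq_inner inner_diff_left inner_diff_right inner_commute)
    ultimately have "(norm (d - p))\<^sup>2 \<le> (norm (d - v))\<^sup>2"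
      by simp
    then show ?thesis
      by (simp add: dist_norm)
  qed
  then have "p = closest_point (simplex_b b) d"
    using p by (intro closest_point_unique convex_simplex_b closed_simplex_b) auto
  then show ?thesis
    by (simp add: proj_simplex_def p_def)
qed

text \<open>Uniqueness comes from \<open>b > 0\<close>: some coordinate exceeds \<open>t\<close>,
  and its positive projected value determines the level.\<close>

lemma pivot_eqI:
  fixes d :: "real ^ 'n"
  assumes "(\<Sum>i\<in>UNIV. max (d $ i - t) 0) = b" "b > 0"
  shows "pivot b d = t"
  unfolding pivot_def
proof (rule the_equality)
  show "\<forall>i. proj_simplex b d $ i = max (d $ i - t) 0"
    by (simp add: proj_simplex_eqI[OF assms(1)])
next
  fix s assume s: "\<forall>i. proj_simplex b d $ i = max (d $ i - s) 0"
  have "\<exists>i. d $ i > t"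
  proof (rule ccontr)
    assume "\<nexists>i. d $ i > t"
    then have "(\<Sum>i\<in>UNIV. max (d $ i - t) 0) = 0"
      by (intro sum.neutral) (auto simp: not_less)
    then show False using assms by simp
  qed
  then obtain i where "d $ i > t" ..
  then show "s = t"
    using s[rule_format, of i] by (simp add: proj_simplex_eqI[OF assms(1)] max_def split: if_splits)
qed

section \<open>Active indices and pairs of them\<close>

text \<open>The excess is nonincreasing in the level, and strictly smaller at \<open>d $ j\<close>
  than at the pivot if \<open>d $ j\<close> is above it. This expresses activity through the
  coordinates alone, which suits integration over one of them.\<close>

lemma active_set_eq:
  fixes d :: "real ^ 'n"
  assumes "b > 0"
  shows "active_set b d = {j. (\<Sum>i\<in>UNIV. max (d $ i - d $ j) 0) < b}"
proof -
  obtain t where t: "(\<Sum>i\<in>UNIV. max (d $ i - t) 0) = b"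
    using exists_excess_level[of UNIV b "\<lambda>i. d $ i"] assms by auto
  have "d $ j > t \<longleftrightarrow> (\<Sum>i\<in>UNIV. max (d $ i - d $ j) 0) < b" for j
  proof
    assume "d $ j > t"
    then have "(\<Sum>i\<in>UNIV. max (d $ i - d $ j) 0) < (\<Sum>i\<in>UNIV. max (d $ i - t) 0)"
      by (intro sum_strict_mono_ex1 ballI bexI[of _ j]) auto
    then show "(\<Sum>i\<in>UNIV. max (d $ i - d $ j) 0) < b" using t by simp
  next
    assume *: "(\<Sum>i\<in>UNIV. max (d $ i - d $ j) 0) < b"
    show "d $ j > t"
    proof (rule ccontr)
      assume "\<not> d $ j > t"
      then have "(\<Sum>i\<in>UNIV. max (d $ i - t) 0) \<le> (\<Sum>i\<in>UNIV. max (d $ i - d $ j) 0)"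
        by (intro sum_mono) auto
      then show False using * t by simp
    qed
  qed
  then show ?thesis
    by (simp add: active_set_def pivot_eqI[OF t assms])
qed

text \<open>An index weakly above an active one is active, so every pair of active indices is counted here
  in at least one order; ties are counted in both, which avoids showing that they are null events.\<close>

definition dominated_pairs :: "real \<Rightarrow> ('n::finite \<Rightarrow> real) \<Rightarrow> 'n \<Rightarrow> ennreal" where
  "dominated_pairs b x j = (\<Sum>i\<in>UNIV - {j}.
     indicator {x. x j \<le> x i \<and> (\<Sum>k\<in>UNIV - {j}. max (x k - x j) 0) < b} x)"

lemma card_active_set_pairs_le:
  fixes d :: "real ^ 'n"
  assumes "b > 0"
  shows "ennreal (real (card (active_set b d)) * (real (card (active_set b d)) - 1))
    \<le> 2 * (\<Sum>j\<in>UNIV. dominated_pairs b (\<lambda>i. d $ i) j)"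
proof -
  define A where "A = active_set b d"
  \<comment> \<open>The summand at \<open>j\<close> is zero, so the condition compares
    \<open>b\<close> with the excess of the other coordinates at level \<open>d $ j\<close>.\<close>
  have A: "j \<in> A \<longleftrightarrow> (\<Sum>k\<in>UNIV - {j}. max (d $ k - d $ j) 0) < b" for j
    by (simp add: A_def active_set_eq[OF assms] sum.remove[of UNIV j])
  define c :: "'n \<Rightarrow> 'n \<Rightarrow> real" where "c j i = (if d $ j \<le> d $ i \<and> j \<in> A then 1 else 0)" for i j
  have dp: "dominated_pairs b (\<lambda>i. d $ i) j = ennreal (\<Sum>i\<in>UNIV - {j}. c j i)" for j
  proof -
    have "dominated_pairs b (\<lambda>i. d $ i) j = (\<Sum>i\<in>UNIV - {j}. ennreal (c j i))"
      unfolding dominated_pairs_def c_def A by (intro sum.cong refl) (simp add: indicator_def)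
    then show ?thesis
      by (simp add: c_def sum_ennreal)
  qed
  define a :: "'n \<Rightarrow> real" where "a i = (if i \<in> A then 1 else 0)" for i
  have S: "(\<Sum>i\<in>UNIV. a i) = real (card A)"
    by (simp add: a_def sum.If_cases)
  have "real (card A) * (real (card A) - 1) = (\<Sum>j\<in>UNIV. a j * (real (card A) - 1))"
    by (simp add: S[symmetric] sum_distrib_right)
  also have "\<dots> = (\<Sum>j\<in>UNIV. \<Sum>i\<in>UNIV - {j}. a j * a i)"
  proof (rule sum.cong)
    fix j
    have "(\<Sum>i\<in>UNIV - {j}. a j * a i) = a j * (real (card A) - a j)"
      by (simp add: sum_distrib_left[symmetric] sum_diff1 S)
    \<comment> \<open>As \<open>a j\<close> is 0 or 1, it equals its square.\<close>
    then show "a j * (real (card A) - 1) = (\<Sum>i\<in>UNIV - {j}. a j * a i)"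
      by (simp add: a_def)
  qed simp
  also have "\<dots> \<le> (\<Sum>j\<in>UNIV. \<Sum>i\<in>UNIV - {j}. c j i + c i j)"
    by (intro sum_mono) (auto simp: a_def c_def)
  also have "\<dots> = (\<Sum>j\<in>UNIV. \<Sum>i\<in>UNIV - {j}. c j i) + (\<Sum>j\<in>UNIV. \<Sum>i\<in>UNIV - {j}. c i j)"
    by (simp add: sum.distrib)
  \<comment> \<open>Exchanging the order of summation identifies the two double sums; this is the
    origin of the factor 2.\<close>
  also have "(\<Sum>j\<in>UNIV. \<Sum>i\<in>UNIV - {j}. c i j) = (\<Sum>i\<in>UNIV. \<Sum>j\<in>UNIV - {i}. c i j)"
  proof -
    have *: "UNIV - {j} = {i\<in>UNIV. i \<noteq> j}" "UNIV - {j} = {i\<in>UNIV. j \<noteq> i}" for j :: 'n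
      by auto
    show ?thesis
      by (subst *(1), subst *(2)) (rule sum.swap_restrict, auto)
  qed
  finally have "real (card A) * (real (card A) - 1) \<le> 2 * (\<Sum>j\<in>UNIV. \<Sum>i\<in>UNIV - {j}. c j i)"
    by simp
  then have "ennreal (real (card A) * (real (card A) - 1))
      \<le> ennreal (2 * (\<Sum>j\<in>UNIV. \<Sum>i\<in>UNIV - {j}. c j i))"
    by (rule ennreal_leI)
  also have "\<dots> = 2 * (\<Sum>j\<in>UNIV. dominated_pairs b (\<lambda>i. d $ i) j)"
    by (simp add: dp ennreal_mult sum_nonneg c_def)
  finally show ?thesis by (simp add: A_def)
qed

section \<open>Integration over a single coordinate\<close>

text \<open>Let \<open>s\<close> be the level of excess exactly \<open>b\<close>. Monotonicity
  confines the set of index \<open>i\<close> to \<open>{s<..x i}\<close>, and the lengths of these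
  intervals add up to the excess at \<open>s\<close>.\<close>

lemma nn_integral_count_above_le:
  fixes x :: "'i \<Rightarrow> real"
  assumes "finite I" "b > 0"
  shows "(\<integral>\<^sup>+t. (\<Sum>i\<in>I. indicator {t. t \<le> x i \<and> (\<Sum>k\<in>I. max (x k - t) 0) < b} t) \<partial>lborel) \<le> ennreal b"
proof (cases "I = {}")
  case False
  then obtain s where s: "(\<Sum>i\<in>I. max (x i - s) 0) = b"
    using exists_excess_level[of I b x] assms by auto
  have "t > s" if "(\<Sum>k\<in>I. max (x k - t) 0) < b" for t
  proof (rule ccontr)
    assume "\<not> t > s"
    then have "(\<Sum>i\<in>I. max (x i - s) 0) \<le> (\<Sum>k\<in>I. max (x k - t) 0)"
      by (intro sum_mono) auto
    then show False using that s by simp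
  qed
  then have "(\<integral>\<^sup>+t. (\<Sum>i\<in>I. indicator {t. t \<le> x i \<and> (\<Sum>k\<in>I. max (x k - t) 0) < b} t) \<partial>lborel)
      \<le> (\<integral>\<^sup>+t. (\<Sum>i\<in>I. indicator {s<..x i} t) \<partial>lborel)"
    by (intro nn_integral_mono sum_mono) (auto simp: indicator_def)
  also have "\<dots> = (\<Sum>i\<in>I. emeasure lborel {s<..x i})"
    by (subst nn_integral_sum) auto
  also have "\<dots> = (\<Sum>i\<in>I. ennreal (max (x i - s) 0))"
  proof (rule sum.cong)
    fix i
    show "emeasure lborel {s<..x i} = ennreal (max (x i - s) 0)"
      by (cases "s \<le> x i") auto
  qed simp
  also have "\<dots> = ennreal b"
    by (subst sum_ennreal) (auto simp: s)
  finally show ?thesis .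
qed simp

lemma measurable_dominated_pairs [measurable]:
  fixes j :: "'n::finite"
  shows "(\<lambda>x. dominated_pairs b x j) \<in> borel_measurable (\<Pi>\<^sub>M i\<in>UNIV. borel)"
proof -
  note intros = borel_measurable_le borel_measurable_sum borel_measurable_max borel_measurable_diff
    borel_measurable_const measurable_component_singleton UNIV_I
  have [measurable]:
    "Measurable.pred (\<Pi>\<^sub>M i\<in>UNIV. borel) (\<lambda>x. x j \<le> (x i :: real))" for i :: 'n
    unfolding pred_def by (intro intros)
  have [measurable]: "Measurable.pred (\<Pi>\<^sub>M i\<in>UNIV. borel)
      (\<lambda>x. (\<Sum>k\<in>UNIV - {j}. max (x k - x j) 0) < b)"
    by (intro borel_measurable_pred_less intros)
  show ?thesis
    unfolding dominated_pairs_def by measurable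
qed

text \<open>By Tonelli, coordinate \<open>j\<close> is integrated first with the others frozen. Its
  density \<open>1 / (u - l)\<close> scales the bound \<open>b\<close> on the Lebesgue
  integral.\<close>

lemma nn_integral_dominated_pairs_le:
  fixes l u b :: real and j :: "'n::finite"
  assumes "l < u" "b > 0"
  shows "(\<integral>\<^sup>+x. dominated_pairs b x j \<partial>(\<Pi>\<^sub>M i\<in>UNIV. uniform_measure lborel {l..u})) \<le> ennreal (b / (u - l))"
proof -
  let ?U = "uniform_measure lborel {l..u}"
  interpret U: prob_space ?U
    using assms by (intro prob_space_uniform_measure) auto
  interpret P: product_prob_space "\<lambda>_::'n. ?U" UNIV ..
  interpret P': prob_space "\<Pi>\<^sub>M i\<in>UNIV - {j}. ?U"
    by (intro prob_space_PiM U.prob_space_axioms)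
  have inner: "(\<integral>\<^sup>+t. dominated_pairs b (x(j := t)) j \<partial>?U) \<le> ennreal (b / (u - l))" for x :: "'n \<Rightarrow> real"
  proof -
    let ?h = "\<lambda>t. \<Sum>i\<in>UNIV - {j}. indicator {t. t \<le> x i \<and> (\<Sum>k\<in>UNIV - {j}. max (x k - t) 0) < b} t :: ennreal"
    have "dominated_pairs b (x(j := t)) j = ?h t" for t
      unfolding dominated_pairs_def by (intro sum.cong refl) (auto simp: indicator_def)
    then have "(\<integral>\<^sup>+t. dominated_pairs b (x(j := t)) j \<partial>?U) = (\<integral>\<^sup>+t. ?h t \<partial>?U)"
      by simp
    also have "\<dots> = (\<integral>\<^sup>+t. ?h t * indicator {l..u} t \<partial>lborel) / emeasure lborel {l..u}"
      by (rule nn_integral_uniform_measure) measurable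
    \<comment> \<open>Extending the integral from \<open>{l..u}\<close> to the whole line can only
      increase it.\<close>
    also have "\<dots> \<le> (\<integral>\<^sup>+t. ?h t \<partial>lborel) / emeasure lborel {l..u}"
      by (intro divide_right_mono_ennreal nn_integral_mono) (auto simp: indicator_def)
    also have "\<dots> \<le> ennreal b / emeasure lborel {l..u}"
      by (intro divide_right_mono_ennreal nn_integral_count_above_le assms) auto
    also have "\<dots> = ennreal (b / (u - l))"
      using assms by (simp add: divide_ennreal)
    finally show ?thesis .
  qed
  have ins: "insert j (UNIV - {j}) = UNIV" by auto
  have "sets (\<Pi>\<^sub>M i\<in>(UNIV::'n set). ?U) = sets (\<Pi>\<^sub>M i\<in>UNIV. borel)"
    by (intro sets_PiM_cong) auto
  then have meas: "(\<lambda>x. dominated_pairs b x j) \<in> borel_measurable (\<Pi>\<^sub>M i\<in>insert j (UNIV - {j}). ?U)"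
    unfolding ins using measurable_dominated_pairs measurable_cong_sets by blast
  have "(\<integral>\<^sup>+x. dominated_pairs b x j \<partial>(\<Pi>\<^sub>M i\<in>UNIV. ?U))
      = (\<integral>\<^sup>+x. (\<integral>\<^sup>+t. dominated_pairs b (x(j := t)) j \<partial>?U) \<partial>(\<Pi>\<^sub>M i\<in>UNIV - {j}. ?U))"
    using P.product_nn_integral_insert[OF _ _ meas] by (simp add: ins)
  also have "\<dots> \<le> (\<integral>\<^sup>+x. ennreal (b / (u - l)) \<partial>(\<Pi>\<^sub>M i\<in>UNIV - {j}. ?U))"
    by (intro nn_integral_mono inner)
  also have "\<dots> = ennreal (b / (u - l))"
    by (simp add: P'.emeasure_space_1)
  finally show ?thesis .
qed

section \<open>From the pair count to the expectation\<close>

theorem theorem3p1: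
  fixes M :: "'a measure" and d :: "'a \<Rightarrow> real ^ 'n" and l u b :: real
  assumes "prob_space M"
    and "l < u"
    and "b > 0"
    and "prob_space.indep_vars M (\<lambda>_. borel) (\<lambda>i \<omega>. d \<omega> $ i) UNIV"
    and "\<And>i. distr M borel (\<lambda>\<omega>. d \<omega> $ i) = uniform_measure lborel {l..u}"
  shows "(\<integral>\<omega>. real (card (active_set b (d \<omega>))) \<partial>M)
    < sqrt (2 * b * (real CARD('n) + 1) / (u - l) + 1 / 4) + 1 / 2"
proof -
  interpret prob_space M by fact
  have rv [measurable]: "(\<lambda>\<omega>. d \<omega> $ i) \<in> borel_measurable M" for i
    using assms(4) by (simp add: indep_vars_def2)
  define K where "K \<omega> = real (card (active_set b (d \<omega>)))" for \<omega>
  \<comment> \<open>Writing \<open>K\<close> as a finite sum of indicators of coordinate conditions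
    makes its measurability evident.\<close>
  have "K \<omega> = (\<Sum>j\<in>UNIV. if (\<Sum>i\<in>UNIV. max (d \<omega> $ i - d \<omega> $ j) 0) < b then 1 else 0)" for \<omega>
    by (simp add: K_def active_set_eq[OF assms(3)] sum.If_cases)
  then have K_meas [measurable]: "K \<in> borel_measurable M"
    by (subst measurable_cong) (assumption, measurable)
  have K_bound: "0 \<le> K \<omega>" "K \<omega> \<le> real CARD('n)" for \<omega>
    by (auto simp: K_def card_mono)
  \<comment> \<open>\<open>K\<close> takes natural values, so it avoids the interval between 0 and 1
    where the product is negative.\<close>
  have KK: "0 \<le> K \<omega> * (K \<omega> - 1)" for \<omega>
    by (cases "card (active_set b (d \<omega>))") (auto simp: K_def)
  have K_int [simp]: "integrable M K"
    using K_bound by (intro integrable_const_bound[of _ "real CARD('n)"]) auto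
  have K2_int [simp]: "integrable M (\<lambda>\<omega>. (K \<omega>)\<^sup>2)"
    using K_bound by (intro integrable_const_bound[of _ "(real CARD('n))\<^sup>2"]) (auto simp: power_mono)
  \<comment> \<open>Independence makes the joint law the product of the uniform marginals.\<close>
  have D: "distr M (\<Pi>\<^sub>M i\<in>UNIV. borel) (\<lambda>\<omega> i. d \<omega> $ i) = (\<Pi>\<^sub>M i\<in>UNIV. uniform_measure lborel {l..u})"
    using assms(4) by (simp add: indep_vars_iff_distr_eq_PiM assms(5) restrict_UNIV)
  have dp: "(\<integral>\<^sup>+\<omega>. dominated_pairs b (\<lambda>i. d \<omega> $ i) j \<partial>M) \<le> ennreal (b / (u - l))" for j
  proof -
    have "(\<integral>\<^sup>+\<omega>. dominated_pairs b (\<lambda>i. d \<omega> $ i) j \<partial>M)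
        = (\<integral>\<^sup>+x. dominated_pairs b x j \<partial>distr M (\<Pi>\<^sub>M i\<in>UNIV. borel) (\<lambda>\<omega> i. d \<omega> $ i))"
      by (subst nn_integral_distr) (auto intro!: measurable_PiM_single')
    then show ?thesis
      using nn_integral_dominated_pairs_le[OF assms(2,3), of j] by (simp add: D)
  qed
  have dp_meas [measurable]: "(\<lambda>\<omega>. dominated_pairs b (\<lambda>i. d \<omega> $ i) j) \<in> borel_measurable M" for j
    by (rule measurable_compose[OF _ measurable_dominated_pairs]) (auto intro!: measurable_PiM_single')
  have "ennreal (\<integral>\<omega>. K \<omega> * (K \<omega> - 1) \<partial>M) = (\<integral>\<^sup>+\<omega>. ennreal (K \<omega> * (K \<omega> - 1)) \<partial>M)"
    using KK by (intro nn_integral_eq_integral[symmetric])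
      (auto simp: right_diff_distrib power2_eq_square[symmetric])
  also have "\<dots> \<le> (\<integral>\<^sup>+\<omega>. 2 * (\<Sum>j\<in>UNIV. dominated_pairs b (\<lambda>i. d \<omega> $ i) j) \<partial>M)"
    unfolding K_def by (intro nn_integral_mono card_active_set_pairs_le assms)
  also have "\<dots> = 2 * (\<Sum>j\<in>UNIV. \<integral>\<^sup>+\<omega>. dominated_pairs b (\<lambda>i. d \<omega> $ i) j \<partial>M)"
    by (simp add: nn_integral_cmult nn_integral_sum)
  also have "\<dots> \<le> 2 * (\<Sum>j\<in>(UNIV::'n set). ennreal (b / (u - l)))"
    by (intro mult_left_mono sum_mono dp) auto
  also have "\<dots> = ennreal (2 * (\<Sum>j\<in>(UNIV::'n set). b / (u - l)))"
    using assms by (subst sum_ennreal) (auto simp: ennreal_mult' simp del: sum_constant)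
  finally have "(\<integral>\<omega>. K \<omega> * (K \<omega> - 1) \<partial>M) \<le> 2 * (\<Sum>j\<in>(UNIV::'n set). b / (u - l))"
    using assms by (subst (asm) ennreal_le_iff) auto
  \<comment> \<open>The strict inequality arises here, from replacing \<open>n\<close> by
    \<open>n + 1\<close> with \<open>b / (u - l)\<close> positive.\<close>
  also have "\<dots> < 2 * b * (real CARD('n) + 1) / (u - l)"
    using assms by (simp add: field_simps)
  finally have pairs: "(\<integral>\<omega>. K \<omega> * (K \<omega> - 1) \<partial>M) < 2 * b * (real CARD('n) + 1) / (u - l)" .
  have "0 \<le> variance K"
    by simp
  also have "\<dots> = expectation (\<lambda>\<omega>. (K \<omega>)\<^sup>2) - (expectation K)\<^sup>2"
    by (rule variance_eq) auto
  also have "expectation (\<lambda>\<omega>. (K \<omega>)\<^sup>2) = (\<integral>\<omega>. K \<omega> * (K \<omega> - 1) \<partial>M) + expectation K"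
    by (simp add: right_diff_distrib power2_eq_square[symmetric])
  \<comment> \<open>Nonnegative variance bounds
    \<open>(expectation K)\<^sup>2 - expectation K\<close> by the pair expectation; completing the
    square adds \<open>1 / 4\<close>.\<close>
  finally have "(expectation K - 1 / 2)\<^sup>2 < 2 * b * (real CARD('n) + 1) / (u - l) + 1 / 4"
    using pairs by (simp add: power2_eq_square algebra_simps)
  then have "expectation K - 1 / 2 < sqrt (2 * b * (real CARD('n) + 1) / (u - l) + 1 / 4)"
    by (rule real_less_rsqrt)
  then show ?thesis
    by (simp add: K_def[symmetric])
qed

end
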